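(* For every $2$-connected graph $F$ and every positive integer $k$, there exists an $F$-WORM colorable graph $G$ with $W^-(G,F)=k$.
   Context: All graphs are finite and simple. For graphs $F$ and $G$, an $F$-WORM coloring of $G$ is an assignment of colors to the vertices of $G$ such that no subgraph of $G$ isomorphic to $F$ (not necessarily induced) is monochromatic (all its vertices have the same color) or rainbow (its vertices have pairwise distinct colors). $G$ is $F$-WORM colorable if it has at least one $F$-WORM coloring; in that case $W^-(G,F)$ denotes the minimum number of colors used in an $F$-WORM coloring of $G$. *)

theory Defs
  imports "Graph_Theory.Graph_Theory"
begin

text \<open>
  A finite simple graph is a pair digraph satisfying \<^locale>\<open>pair_graph\<close>: an undirected edge
  \<open>uv\<close> is represented by the two arcs \<open>(u, v)\<close> and \<open>(v, u)\<close>.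
\<close>

text \<open>
  The convention that a 2-connected graph has at least three vertices matters: with \<open>K\<^sub>2\<close>
  admitted, every edge of \<open>G\<close> would be monochromatic or rainbow under any coloring.
\<close>

definition two_connected :: "'a pair_pre_digraph \<Rightarrow> bool" where
  "two_connected G \<longleftrightarrow>
     card (pverts G) \<ge> 3 \<and> connected (with_proj G) \<and>
     (\<forall>v \<in> pverts G. connected (pre_digraph.del_vert (with_proj G) v))"

definition monochromatic :: "('a \<Rightarrow> 'c) \<Rightarrow> 'a pair_pre_digraph \<Rightarrow> bool" where
  "monochromatic c H \<longleftrightarrow> (\<forall>u \<in> pverts H. \<forall>v \<in> pverts H. c u = c v)"

definition rainbow :: "('a \<Rightarrow> 'c) \<Rightarrow> 'a pair_pre_digraph \<Rightarrow> bool" where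
  "rainbow c H \<longleftrightarrow> inj_on c (pverts H)"

text \<open>
  The condition \<open>pair_graph H\<close> is there because \<^const>\<open>subgraph\<close> is the notion for digraphs, under
  which a subgraph of a symmetric digraph need not be symmetric.
\<close>

definition worm_coloring ::
    "'a pair_pre_digraph \<Rightarrow> 'b pair_pre_digraph \<Rightarrow> ('a \<Rightarrow> 'c) \<Rightarrow> bool" where
  "worm_coloring G F c \<longleftrightarrow>
     (\<forall>H :: 'a pair_pre_digraph.
        pair_graph H \<and> subgraph (with_proj H) (with_proj G) \<and>
        digraph_iso (with_proj F) (with_proj H) \<longrightarrow>
        \<not> monochromatic c H \<and> \<not> rainbow c H)"

text \<open>As graphs are finite, natural numbers suffice as colors.\<close>

definition worm_colorable :: "'a pair_pre_digraph \<Rightarrow> 'b pair_pre_digraph \<Rightarrow> bool" where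
  "worm_colorable G F \<longleftrightarrow> (\<exists>c :: 'a \<Rightarrow> nat. worm_coloring G F c)"

text \<open>Only meaningful if \<open>worm_colorable G F\<close>; otherwise the value is unspecified.\<close>

definition W_minus :: "'a pair_pre_digraph \<Rightarrow> 'b pair_pre_digraph \<Rightarrow> nat" where
  "W_minus G F =
     (LEAST n. \<exists>c :: 'a \<Rightarrow> nat. worm_coloring G F c \<and> card (c ` pverts G) = n)"

end

theory Submission
  imports Defs "HOL-Library.Nat_Bijection"
begin

text \<open>
  Let \<open>n\<close> be the order of \<open>F\<close>. Take an \<open>n\<close>-uniform hypergraph of large girth in which every coloring
  with \<open>k - 1\<close> colors has a monochromatic edge, but which has a coloring with \<open>k\<close> colors whose edges
  are neither monochromatic nor rainbow, and plant a copy of \<open>F\<close> on each edge. By large girth, a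
  copy of \<open>F\<close> spread over several hyperedges would have a cut vertex, so the planted copies are the
  only ones. The hypergraph comes from the partite amalgamation of Nesetril and Rodl, which starts
  from disjoint edges transversal to a system of parts; since the parts survive the construction,
  the coloring with \<open>k\<close> colors can be fixed on them in advance.
\<close>

section \<open>Sparse hypergraphs\<close>

text \<open>
  A counting form of ``no Berge cycle of length at most \<open>g\<close>'': the incidence graph between a
  subfamily \<open>C\<close> of at most \<open>g\<close> edges and the vertices has no more incidences than a forest.
  Admitting arbitrary traces \<open>T c \<subseteq> c\<close> avoids arguing about cycles.
\<close>

definition sparse :: "nat \<Rightarrow> 'a set set \<Rightarrow> bool" where
  "sparse g E \<longleftrightarrow>
     (\<forall>C T. C \<subseteq> E \<and> finite C \<and> C \<noteq> {} \<and> card C \<le> g \<and> (\<forall>c\<in>C. T c \<subseteq> c) \<longrightarrow>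
        (\<Sum>c\<in>C. card (T c)) + 1 \<le> card (\<Union>c\<in>C. T c) + card C)"

lemma sparseD:
  assumes "sparse g E" "C \<subseteq> E" "finite C" "C \<noteq> {}" "card C \<le> g" "\<And>c. c \<in> C \<Longrightarrow> T c \<subseteq> c"
  shows "(\<Sum>c\<in>C. card (T c)) + 1 \<le> card (\<Union>c\<in>C. T c) + card C"
  using assms unfolding sparse_def by blast

lemma sparse_zero: "sparse 0 E"
  by (auto simp: sparse_def)

lemma sparse_disjoint:
  assumes "finite (\<Union>E)" "pairwise disjnt E"
  shows "sparse g E"
  unfolding sparse_def
proof (intro allI impI, elim conjE)
  fix C and T :: "'a set \<Rightarrow> 'a set"
  assume C: "C \<subseteq> E" "finite C" "C \<noteq> {}" and T: "\<forall>c\<in>C. T c \<subseteq> c"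
  have fin: "\<forall>c\<in>C. finite (T c)"
  proof
    fix c assume "c \<in> C"
    then have "T c \<subseteq> \<Union>E" using C T by auto
    then show "finite (T c)" using assms(1) by (rule finite_subset)
  qed
  have "\<forall>c\<in>C. \<forall>d\<in>C. c \<noteq> d \<longrightarrow> T c \<inter> T d = {}"
  proof (intro ballI impI)
    fix c d assume cd: "c \<in> C" "d \<in> C" "c \<noteq> d"
    then have "c \<inter> d = {}" using assms(2) C(1) by (meson disjnt_def pairwiseD subsetD)
    then show "T c \<inter> T d = {}" using T cd by blast
  qed
  then have "card (\<Union>c\<in>C. T c) = (\<Sum>c\<in>C. card (T c))"
    using card_UN_disjoint[OF C(2) fin] by simp
  moreover have "card C \<ge> 1"
    using C by (simp add: Suc_le_eq card_gt_0_iff)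
  ultimately show "(\<Sum>c\<in>C. card (T c)) + 1 \<le> card (\<Union>c\<in>C. T c) + card C"
    by simp
qed

lemma sparse_image:
  assumes "sparse g E" "inj_on f (\<Union>E)"
  shows "sparse g ((`) f ` E)"
  unfolding sparse_def
proof (intro allI impI, elim conjE)
  fix C T assume C: "C \<subseteq> (`) f ` E" "finite C" "C \<noteq> {}" "card C \<le> g" and T: "\<forall>c\<in>C. T c \<subseteq> c"
  obtain D where D: "D \<subseteq> E" "C = (`) f ` D"
    using C(1) by (meson subset_imageE)
  have inj: "inj_on ((`) f) D"
  proof (rule inj_onI)
    fix x y assume "x \<in> D" "y \<in> D" "f ` x = f ` y"
    moreover have "x \<subseteq> \<Union>E" "y \<subseteq> \<Union>E" using \<open>x \<in> D\<close> \<open>y \<in> D\<close> D by auto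
    ultimately show "x = y"
      using inj_on_image_eq_iff[OF assms(2)] by blast
  qed
  have finD: "finite D" using C(2) D inj finite_image_iff by blast
  \<comment> \<open>The traces of the image edges, pulled back to the original edges.\<close>
  define S where "S e = {v \<in> e. f v \<in> T (f ` e)}" for e
  have ST: "f ` S e = T (f ` e)" if "e \<in> D" for e
    using T D that unfolding S_def by auto
  have SE: "S e \<subseteq> \<Union>E" if "e \<in> D" for e
    using D that unfolding S_def by auto
  have cardS: "card (T (f ` e)) = card (S e)" if "e \<in> D" for e
    using card_image[OF inj_on_subset[OF assms(2) SE[OF that]]] ST[OF that] by simp
  have "(\<Sum>e\<in>D. card (S e)) + 1 \<le> card (\<Union>e\<in>D. S e) + card D"
    using sparseD[OF assms(1) D(1) finD, of S] C D card_image[OF inj] by (auto simp: S_def)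
  moreover have "(\<Sum>c\<in>C. card (T c)) = (\<Sum>e\<in>D. card (S e))"
    using D(2) inj cardS by (simp add: sum.reindex)
  moreover have "card (\<Union>c\<in>C. T c) = card (\<Union>e\<in>D. S e)"
  proof -
    have "(\<Union>c\<in>C. T c) = f ` (\<Union>e\<in>D. S e)"
      using ST D(2) by (auto simp: image_UN)
    moreover have "inj_on f (\<Union>e\<in>D. S e)"
      using SE inj_on_subset[OF assms(2)] by (meson UN_least)
    ultimately show ?thesis by (simp add: card_image)
  qed
  ultimately show "(\<Sum>c\<in>C. card (T c)) + 1 \<le> card (\<Union>c\<in>C. T c) + card C"
    using card_image[OF inj] D(2) by simp
qed

text \<open>A trace with at most one vertex adds at most 1 to the left side and exactly 1 to
  \<open>card K\<close>, so only traces with two or more vertices call for sparsity, and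
  \<open>h\<close> has to bound only their number. If there are none, the extra 1 is paid by a
  vertex of the union, or by \<open>card K\<close> if all traces are empty.\<close>

lemma sparse_few_large_traces:
  assumes "sparse h H" "K \<subseteq> H" "finite K" "K \<noteq> {}"
    and S: "\<And>c. c \<in> K \<Longrightarrow> S c \<subseteq> c" "\<And>c. c \<in> K \<Longrightarrow> finite (S c)"
    and few: "card {c \<in> K. 2 \<le> card (S c)} \<le> h"
  shows "(\<Sum>c\<in>K. card (S c)) + 1 \<le> card (\<Union>c\<in>K. S c) + card K"
proof -
  define B where "B = {c \<in> K. 2 \<le> card (S c)}"
  have BK: "B \<subseteq> K" "finite B" using assms(3) by (auto simp: B_def)
  have "(\<Sum>c\<in>K-B. card (S c)) \<le> (\<Sum>c\<in>K-B. 1)"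
    by (rule sum_mono) (auto simp: B_def)
  then have small: "(\<Sum>c\<in>K-B. card (S c)) \<le> card (K - B)" by simp
  have split: "(\<Sum>c\<in>K. card (S c)) = (\<Sum>c\<in>K-B. card (S c)) + (\<Sum>c\<in>B. card (S c))"
    by (rule sum.subset_diff[OF BK(1) assms(3)])
  have cK: "card K = card (K - B) + card B"
    using BK assms(3) by (metis card_Diff_subset card_mono le_add_diff_inverse2)
  have finU: "finite (\<Union>c\<in>K. S c)" using S(2) assms(3) by auto
  show ?thesis
  proof (cases "B = {}")
    case False
    have "(\<Sum>c\<in>B. card (S c)) + 1 \<le> card (\<Union>c\<in>B. S c) + card B"
      using sparseD[OF assms(1), of B S] BK assms(2) False few S(1) unfolding B_def by blast
    moreover have "card (\<Union>c\<in>B. S c) \<le> card (\<Union>c\<in>K. S c)"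
      using finU BK by (intro card_mono) auto
    ultimately show ?thesis using small split cK by linarith
  next
    case True
    show ?thesis
    proof (cases "(\<Union>c\<in>K. S c) = {}")
      case True
      then have "(\<Sum>c\<in>K. card (S c)) = 0" by auto
      then show ?thesis using assms(3,4) by (simp add: Suc_le_eq card_gt_0_iff)
    next
      case ne: False
      then have "card (\<Union>c\<in>K. S c) \<ge> 1"
        using finU by (metis One_nat_def Suc_leI card_gt_0_iff)
      moreover have "(\<Sum>c\<in>K. card (S c)) \<le> card K" using small True by simp
      ultimately show ?thesis by linarith
    qed
  qed
qed

text \<open>
  Here sparsity doubles: an edge meets the core \<open>Y\<close> at most once, so a copy \<open>D c\<close> links two points
  of \<open>Y\<close> only by using at least two of the given edges. Hence at most \<open>g div 2\<close> of the copies matter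
  for the hypergraph \<open>H\<close> along which they are glued.
\<close>

lemma sparse_amalgam:
  assumes H: "sparse (g div 2) H"
    and D: "\<And>c. c \<in> H \<Longrightarrow> sparse g (D c)" "\<And>c. c \<in> H \<Longrightarrow> finite (\<Union>(D c))"
    and meet: "\<And>c d. c \<in> H \<Longrightarrow> d \<in> H \<Longrightarrow> c \<noteq> d \<Longrightarrow> \<Union>(D c) \<inter> \<Union>(D d) \<subseteq> Y"
    and core: "\<And>c. c \<in> H \<Longrightarrow> \<Union>(D c) \<inter> Y \<subseteq> c"
    and thin: "\<And>c e. c \<in> H \<Longrightarrow> e \<in> D c \<Longrightarrow> card (e \<inter> Y) \<le> 1"
  shows "sparse g (\<Union>c\<in>H. D c)"
  unfolding sparse_def
proof (intro allI impI, elim conjE)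
  fix C and T :: "'a set \<Rightarrow> 'a set"
  assume C: "C \<subseteq> (\<Union>c\<in>H. D c)" "finite C" "C \<noteq> {}" "card C \<le> g" and T: "\<forall>e\<in>C. T e \<subseteq> e"
  have "\<forall>e\<in>C. \<exists>c. c \<in> H \<and> e \<in> D c" using C(1) by blast
  \<comment> \<open>Every edge is assigned to a single copy, so that the fibres \<open>Cc c\<close>
    partition \<open>C\<close> and incidences can be counted copy by copy.\<close>
  then obtain h where h: "\<And>e. e \<in> C \<Longrightarrow> h e \<in> H \<and> e \<in> D (h e)" by metis
  define K where "K = h ` C"
  define Cc where "Cc c = {e \<in> C. h e = c}" for c
  define U where "U c = (\<Union>e\<in>Cc c. T e)" for c
  have K: "K \<subseteq> H" "finite K" "K \<noteq> {}" using h C by (auto simp: K_def)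
  have CcD: "Cc c \<subseteq> D c" "finite (Cc c)" "Cc c \<noteq> {}" "card (Cc c) \<le> g" if "c \<in> K" for c
  proof -
    have "Cc c \<subseteq> C" by (auto simp: Cc_def)
    then show "finite (Cc c)" "card (Cc c) \<le> g"
      using C finite_subset card_mono by (blast, meson le_trans)
    show "Cc c \<subseteq> D c" using h by (auto simp: Cc_def)
    show "Cc c \<noteq> {}" using that by (auto simp: Cc_def K_def)
  qed
  have UD: "U c \<subseteq> \<Union>(D c)" if "c \<in> K" for c
    using CcD(1)[OF that] T unfolding U_def Cc_def by blast
  have finU: "finite (U c)" if "c \<in> K" for c
    using UD[OF that] D(2) K that finite_subset by blast
  have UU: "(\<Union>c\<in>K. U c) = (\<Union>e\<in>C. T e)"
    by (auto simp: U_def Cc_def K_def)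
  have loc: "(\<Sum>e\<in>Cc c. card (T e)) + 1 \<le> card (U c) + card (Cc c)" if "c \<in> K" for c
    unfolding U_def
    by (rule sparseD[OF D(1)]) (use CcD[OF that] that K T in \<open>auto simp: Cc_def\<close>)
  have sumT: "(\<Sum>e\<in>C. card (T e)) = (\<Sum>c\<in>K. \<Sum>e\<in>Cc c. card (T e))"
    unfolding K_def Cc_def by (rule sum.image_gen[OF C(2)])
  have sumC: "card C = (\<Sum>c\<in>K. card (Cc c))"
    using sum.image_gen[OF C(2), of "\<lambda>_. 1::nat" h] by (simp add: K_def Cc_def)
  \<comment> \<open>The local inequalities add up with a surplus of \<open>card K\<close>. It
    remains to bound the sum of all \<open>card (U c)\<close> by
    \<open>card (\<Union>c\<in>K. U c) + card K - 1\<close>, which is sparsity with copies in the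
    role of edges.\<close>
  have "(\<Sum>c\<in>K. (\<Sum>e\<in>Cc c. card (T e)) + 1) \<le> (\<Sum>c\<in>K. card (U c) + card (Cc c))"
    using loc by (rule sum_mono)
  then have A: "(\<Sum>e\<in>C. card (T e)) + card K \<le> (\<Sum>c\<in>K. card (U c)) + card C"
    unfolding sumT sumC sum.distrib by simp
  have SCc: "card (U c \<inter> Y) \<le> card (Cc c)" if "c \<in> K" for c
  proof -
    have "card (T e \<inter> Y) \<le> 1" if "e \<in> Cc c" for e
    proof -
      have e: "e \<in> C" "e \<in> D c" "c \<in> H" using that CcD(1)[OF \<open>c \<in> K\<close>] K \<open>c \<in> K\<close> by (auto simp: Cc_def)
      have "finite e" using D(2)[OF e(3)] e(2) by (meson Union_upper finite_subset)
      then have "card (T e \<inter> Y) \<le> card (e \<inter> Y)"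
        using T e by (intro card_mono) auto
      then show ?thesis using thin[OF e(3,2)] by simp
    qed
    then have "(\<Sum>e\<in>Cc c. card (T e \<inter> Y)) \<le> card (Cc c)"
      using sum_mono[of "Cc c" "\<lambda>e. card (T e \<inter> Y)" "\<lambda>_. 1"] by simp
    moreover have "card (\<Union>e\<in>Cc c. T e \<inter> Y) \<le> (\<Sum>e\<in>Cc c. card (T e \<inter> Y))"
      by (rule card_UN_le[OF CcD(2)[OF that]])
    moreover have "U c \<inter> Y = (\<Union>e\<in>Cc c. T e \<inter> Y)" by (auto simp: U_def)
    ultimately show ?thesis by simp
  qed
  have few: "card {c \<in> K. 2 \<le> card (U c \<inter> Y)} \<le> g div 2"
  proof -
    let ?B = "{c \<in> K. 2 \<le> card (U c \<inter> Y)}"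
    have "2 * card ?B = (\<Sum>c\<in>?B. 2)" by simp
    also have "\<dots> \<le> (\<Sum>c\<in>?B. card (Cc c))"
      by (rule sum_mono) (use SCc in \<open>force intro: order_trans\<close>)
    also have "\<dots> \<le> (\<Sum>c\<in>K. card (Cc c))"
      using K by (intro sum_mono2) auto
    finally show ?thesis using sumC C(4) by linarith
  qed
  have Yb: "(\<Sum>c\<in>K. card (U c \<inter> Y)) + 1 \<le> card (\<Union>c\<in>K. U c \<inter> Y) + card K"
    by (rule sparse_few_large_traces[OF H K]) (use core UD finU K few in \<open>auto, blast\<close>)
  have split: "card X = card (X - Y) + card (X \<inter> Y)" if "finite X" for X
    using card_Int_Diff[OF that, of Y] by simp
  \<comment> \<open>Off the core the copies are disjoint, so only vertices of \<open>Y\<close> can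
    be counted more than once.\<close>
  have "card (\<Union>c\<in>K. U c - Y) = (\<Sum>c\<in>K. card (U c - Y))"
  proof (rule card_UN_disjoint[OF K(2)])
    show "\<forall>c\<in>K. finite (U c - Y)" using finU by auto
    show "\<forall>c\<in>K. \<forall>d\<in>K. c \<noteq> d \<longrightarrow> (U c - Y) \<inter> (U d - Y) = {}"
    proof (intro ballI impI)
      fix c d assume cd: "c \<in> K" "d \<in> K" "c \<noteq> d"
      then have "c \<in> H" "d \<in> H" using K(1) by auto
      then show "(U c - Y) \<inter> (U d - Y) = {}"
        using meet[OF _ _ cd(3)] UD[OF cd(1)] UD[OF cd(2)] by blast
    qed
  qed
  moreover have "(\<Union>c\<in>K. U c) - Y = (\<Union>c\<in>K. U c - Y)" "(\<Union>c\<in>K. U c) \<inter> Y = (\<Union>c\<in>K. U c \<inter> Y)"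
    by auto
  moreover have "finite (\<Union>c\<in>K. U c)" using finU K by auto
  ultimately have "card (\<Union>c\<in>K. U c) = (\<Sum>c\<in>K. card (U c - Y)) + card (\<Union>c\<in>K. U c \<inter> Y)"
    using split by metis
  moreover have "(\<Sum>c\<in>K. card (U c)) = (\<Sum>c\<in>K. card (U c - Y)) + (\<Sum>c\<in>K. card (U c \<inter> Y))"
    unfolding sum.distrib[symmetric] by (rule sum.cong) (auto intro: split finU)
  ultimately have "(\<Sum>c\<in>K. card (U c)) + 1 \<le> card (\<Union>e\<in>C. T e) + card K"
    using Yb UU by simp
  then show "(\<Sum>e\<in>C. card (T e)) + 1 \<le> card (\<Union>e\<in>C. T e) + card C"
    using A by linarith
qed

text \<open>
  If every trace shared two vertices with the others, then both vertices and edges would have degree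
  at least 2 in the incidence graph, which is too many incidences for a forest.
\<close>

lemma sparse_leaf:
  assumes "sparse g E" "C \<subseteq> E" "finite C" "C \<noteq> {}" "card C \<le> g"
    and T: "\<And>c. c \<in> C \<Longrightarrow> T c \<subseteq> c" "\<And>c. c \<in> C \<Longrightarrow> finite (T c)"
  obtains c where "c \<in> C" "card (T c \<inter> (\<Union>d\<in>C-{c}. T d)) \<le> 1"
proof (rule ccontr)
  assume "\<not> thesis"
  define S where "S c = T c \<inter> (\<Union>d\<in>C-{c}. T d)" for c
  have big: "2 \<le> card (S c)" if "c \<in> C" for c
    using that \<open>\<not> thesis\<close> \<open>\<And>c. \<lbrakk>c \<in> C; card (T c \<inter> (\<Union>d\<in>C-{c}. T d)) \<le> 1\<rbrakk> \<Longrightarrow> thesis\<close>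
    unfolding S_def by fastforce
  define U where "U = (\<Union>c\<in>C. S c)"
  have finS: "finite (S c)" if "c \<in> C" for c
    using T(2)[OF that] by (simp add: S_def)
  have finU: "finite U" using finS assms(3) by (auto simp: U_def)
  \<comment> \<open>A vertex of \<open>S c\<close> lies in a second trace \<open>T d\<close>, hence
    in \<open>S d\<close> as well.\<close>
  have twice: "2 \<le> card {c \<in> C. v \<in> S c}" if v: "v \<in> U" for v
  proof -
    obtain c d where cd: "c \<in> C" "d \<in> C" "c \<noteq> d" "v \<in> T c" "v \<in> T d"
      using v by (auto simp: U_def S_def)
    then have "{c, d} \<subseteq> {c \<in> C. v \<in> S c}" by (auto simp: S_def)
    then have "card {c, d} \<le> card {c \<in> C. v \<in> S c}"
      using assms(3) by (intro card_mono) auto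
    then show ?thesis using cd by simp
  qed
  have "(\<Sum>c\<in>C. card (S c)) = (\<Sum>c\<in>C. \<Sum>v\<in>U. if v \<in> S c then 1 else 0)"
  proof (rule sum.cong[OF refl])
    fix c assume "c \<in> C"
    then have "U \<inter> S c = S c" by (auto simp: U_def)
    then show "card (S c) = (\<Sum>v\<in>U. if v \<in> S c then 1 else 0)"
      using finU by (simp add: sum.If_cases Int_def[symmetric])
  qed
  also have "\<dots> = (\<Sum>v\<in>U. \<Sum>c\<in>C. if v \<in> S c then 1 else 0)" by (rule sum.swap)
  also have "\<dots> = (\<Sum>v\<in>U. card {c \<in> C. v \<in> S c})"
    using assms(3) by (simp add: sum.If_cases Int_def)
  finally have "2 * card U \<le> (\<Sum>c\<in>C. card (S c))"
    using sum_mono[of U "\<lambda>_. 2" "\<lambda>v. card {c \<in> C. v \<in> S c}"] twice by simp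
  moreover have "2 * card C \<le> (\<Sum>c\<in>C. card (S c))"
    using sum_mono[of C "\<lambda>_. 2" "\<lambda>c. card (S c)"] big by simp
  moreover have "(\<Sum>c\<in>C. card (S c)) + 1 \<le> card U + card C"
    unfolding U_def by (rule sparseD[OF assms(1-5)]) (use T(1) in \<open>auto simp: S_def\<close>)
  ultimately show False by linarith
qed

section \<open>Partite amalgamation\<close>

text \<open>The bound \<open>d < m\<close> matters only for an empty edge. Such edges occur when
  amalgamating along an empty part, where \<open>d\<close> becomes the color assigned to that
  part.\<close>

definition forces_mono :: "nat \<Rightarrow> 'a set set \<Rightarrow> bool" where
  "forces_mono m E \<longleftrightarrow>
     (\<forall>\<chi> :: 'a \<Rightarrow> nat. (\<forall>v. \<chi> v < m) \<longrightarrow> (\<exists>e\<in>E. \<exists>d<m. \<forall>v\<in>e. \<chi> v = d))"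

text \<open>
  The parts are the fibres of \<open>p\<close>. Only colorings that are constant on every part from \<open>i\<close> on are
  considered; each amalgamation step frees one further part.
\<close>

definition partite_forces_mono :: "nat \<Rightarrow> nat \<Rightarrow> ('a \<Rightarrow> nat) \<Rightarrow> 'a set set \<Rightarrow> bool" where
  "partite_forces_mono m i p E \<longleftrightarrow>
     (\<forall>\<chi> f. (\<forall>v. \<chi> v < m) \<and> (\<forall>j. f j < m) \<and> (\<forall>v\<in>\<Union>E. i \<le> p v \<longrightarrow> \<chi> v = f (p v)) \<longrightarrow>
        (\<exists>e\<in>E. \<exists>d<m. \<forall>v\<in>e. \<chi> v = d))"

lemma forces_monoD:
  assumes "forces_mono m E" "\<forall>v. \<chi> v < m"
  shows "\<exists>e\<in>E. \<exists>d<m. \<forall>v\<in>e. \<chi> v = d"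
  using assms unfolding forces_mono_def by blast

lemma partite_forces_monoD:
  assumes "partite_forces_mono m i p E" "\<forall>v. \<chi> v < m" "\<forall>j. f j < m"
    "\<forall>v\<in>\<Union>E. i \<le> p v \<longrightarrow> \<chi> v = f (p v)"
  shows "\<exists>e\<in>E. \<exists>d<m. \<forall>v\<in>e. \<chi> v = d"
  using assms unfolding partite_forces_mono_def by blast

text \<open>The invariant of the amalgamation: \<open>Q\<close> stays fixed, so sizes and color
  patterns of edges can be read off from the parts they meet.\<close>

definition transversal :: "('a \<Rightarrow> nat) \<Rightarrow> nat set set \<Rightarrow> 'a set set \<Rightarrow> bool" where
  "transversal p Q E \<longleftrightarrow> (\<forall>e\<in>E. inj_on p e \<and> p ` e \<in> Q)"

text \<open>The members of \<open>Q\<close> are made disjoint, with \<open>set_encode q\<close> as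
  the tag. A coloring constant on every part is a coloring of the indices, so a monochromatic member
  of \<open>Q\<close> gives a monochromatic edge.\<close>

lemma partite_base:
  assumes "finite Q" "\<And>q. q \<in> Q \<Longrightarrow> finite q"
    and "forces_mono m Q"
  obtains E :: "nat set set" and p where "finite (\<Union>E)" "transversal p Q E" "sparse g E"
    "partite_forces_mono m 0 p E"
proof -
  define \<phi> where "\<phi> q j = prod_encode (set_encode q, j)" for q j
  define E where "E = (\<lambda>q. \<phi> q ` q) ` Q"
  define p where "p v = snd (prod_decode v)" for v
  have p\<phi>: "p (\<phi> q j) = j" for q j by (simp add: p_def \<phi>_def)
  have fin: "finite (\<Union>E)" using assms by (auto simp: E_def)
  have tr: "transversal p Q E"
    by (auto simp: transversal_def E_def inj_on_def image_image p\<phi>)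
  have "pairwise disjnt E"
  proof -
    have "\<phi> q ` q \<inter> \<phi> r ` r = {}" if "q \<in> Q" "r \<in> Q" "q \<noteq> r" for q r
    proof -
      have "set_encode q \<noteq> set_encode r"
        using that assms(2) set_encode_inverse by metis
      then show ?thesis by (auto simp: \<phi>_def)
    qed
    then show ?thesis
      unfolding E_def pairwise_image by (intro pairwiseI) (simp add: disjnt_def)
  qed
  then have sp: "sparse g E" using fin by (rule sparse_disjoint[rotated])
  have "partite_forces_mono m 0 p E"
    unfolding partite_forces_mono_def
  proof (intro allI impI, elim conjE)
    fix \<chi> f :: "nat \<Rightarrow> nat"
    assume f: "\<forall>j. f j < m" and \<chi>: "\<forall>v\<in>\<Union>E. 0 \<le> p v \<longrightarrow> \<chi> v = f (p v)"
    obtain q d where q: "q \<in> Q" "d < m" "\<forall>j\<in>q. f j = d"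
      using forces_monoD[OF assms(3), of f] f by blast
    have "\<chi> v = d" if "v \<in> \<phi> q ` q" for v
    proof -
      have "v \<in> \<Union>E" using that q by (auto simp: E_def)
      then show ?thesis using \<chi> q that by (auto simp: p\<phi>)
    qed
    then show "\<exists>e\<in>E. \<exists>d<m. \<forall>v\<in>e. \<chi> v = d" using q by (auto simp: E_def)
  qed
  with fin tr sp show thesis by (rule that)
qed

text \<open>For every \<open>c\<close> in \<open>H\<close> a copy of \<open>E\<close> is taken whose
  part \<open>i\<close> is glued onto \<open>c\<close>, all other vertices being private to the
  copy. A coloring makes some \<open>c\<close> constant; in the copy over this \<open>c\<close>,
  part \<open>i\<close> has a single color and the hypothesis for \<open>i\<close> applies.\<close>

lemma partite_step:
  fixes E H :: "nat set set"
  assumes E: "finite (\<Union>E)" "transversal p Q E" "sparse g E" "partite_forces_mono m i p E"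
    and H: "finite (\<Union>H)" "sparse (g div 2) H" "forces_mono m H"
      "\<And>c. c \<in> H \<Longrightarrow> card c = card {v \<in> \<Union>E. p v = i}"
  obtains E' :: "nat set set" and p' where "finite (\<Union>E')" "transversal p' Q E'" "sparse g E'"
    "partite_forces_mono m (Suc i) p' E'"
proof -
  \<comment> \<open>Tag 0 is reserved for the common core \<open>Y\<close>; private vertices will
    carry the tag \<open>Suc (set_encode c)\<close>.\<close>
  define \<epsilon> where "\<epsilon> y = prod_encode (0, y)" for y
  define Y where "Y = range \<epsilon>"
  define J where "J = (`) \<epsilon> ` H"
  have inj\<epsilon>: "inj_on \<epsilon> A" for A by (auto simp: inj_on_def \<epsilon>_def)
  have JY: "c \<subseteq> Y" if "c \<in> J" for c using that by (auto simp: J_def Y_def)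
  have finJ: "finite J" using H(1) finite_UnionD by (auto simp: J_def)
  have finc: "finite c" if "c \<in> J" for c
    using that H(1) by (auto simp: J_def intro: finite_subset[OF Union_upper])
  have spJ: "sparse (g div 2) J" unfolding J_def by (rule sparse_image[OF H(2) inj\<epsilon>])
  have "\<exists>b. bij_betw b {v \<in> \<Union>E. p v = i} c" if "c \<in> J" for c
  proof (rule finite_same_card_bij)
    show "finite {v \<in> \<Union>E. p v = i}" by (rule finite_subset[OF _ E(1)]) auto
    show "card {v \<in> \<Union>E. p v = i} = card c"
      using that H(4) by (auto simp: J_def card_image[OF inj\<epsilon>])
  qed (rule finc[OF that])
  then obtain \<beta> where \<beta>: "\<And>c. c \<in> J \<Longrightarrow> bij_betw (\<beta> c) {v \<in> \<Union>E. p v = i} c" by metis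
  define \<phi> where "\<phi> c v = (if p v = i then \<beta> c v else prod_encode (Suc (set_encode c), v))" for c v
  define p' where "p' w = (if w \<in> Y then i else p (snd (prod_decode w)))" for w
  define D where "D c = (`) (\<phi> c) ` E" for c
  define E' where "E' = (\<Union>c\<in>J. D c)"
  have \<beta>c: "\<beta> c v \<in> c" if "c \<in> J" "v \<in> \<Union>E" "p v = i" for c v
    using \<beta>[OF that(1)] that(2,3) by (auto dest: bij_betwE)
  have nY: "prod_encode (Suc x, v) \<notin> Y" for x v by (auto simp: Y_def \<epsilon>_def)
  have p'\<phi>: "p' (\<phi> c v) = p v" if "c \<in> J" "v \<in> \<Union>E" for c v
    using \<beta>c[OF that] JY[OF that(1)] nY by (auto simp: p'_def \<phi>_def)
  have \<phi>Y: "\<phi> c v \<in> Y \<longleftrightarrow> p v = i" if "c \<in> J" "v \<in> \<Union>E" for c v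
    using \<beta>c[OF that] JY[OF that(1)] nY by (auto simp: \<phi>_def)
  have inj\<phi>: "inj_on (\<phi> c) (\<Union>E)" if "c \<in> J" for c
  proof (rule inj_onI)
    fix u v assume uv: "u \<in> \<Union>E" "v \<in> \<Union>E" "\<phi> c u = \<phi> c v"
    then have "p u = p v" using p'\<phi>[OF that] by metis
    then show "u = v"
      using uv bij_betw_imp_inj_on[OF \<beta>[OF that]]
      by (cases "p v = i") (auto simp: \<phi>_def inj_on_def)
  qed
  have UD: "\<Union>(D c) = \<phi> c ` \<Union>E" for c by (auto simp: D_def)
  have fin: "finite (\<Union>E')"
  proof -
    have "\<Union>E' = (\<Union>c\<in>J. \<Union>(D c))" by (auto simp: E'_def)
    then show ?thesis using finJ E(1) UD by simp
  qed
  have tr: "transversal p' Q E'"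
    unfolding transversal_def
  proof
    fix e' assume "e' \<in> E'"
    then obtain c e where ce: "c \<in> J" "e \<in> E" "e' = \<phi> c ` e" by (auto simp: E'_def D_def)
    have eq: "p' (\<phi> c v) = p v" if "v \<in> e" for v using p'\<phi>[OF ce(1)] ce(2) that by blast
    have "inj_on p e" "p ` e \<in> Q" using E(2) ce(2) by (auto simp: transversal_def)
    then show "inj_on p' e' \<and> p' ` e' \<in> Q"
      using eq ce(3) by (auto simp: inj_on_def image_image)
  qed
  have sp: "sparse g E'"
    unfolding E'_def
  proof (rule sparse_amalgam[OF spJ])
    fix c assume c: "c \<in> J"
    show "sparse g (D c)" unfolding D_def by (rule sparse_image[OF E(3) inj\<phi>[OF c]])
    show "finite (\<Union>(D c))" using UD E(1) by simp
    show "\<Union>(D c) \<inter> Y \<subseteq> c"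
    proof
      fix w assume "w \<in> \<Union>(D c) \<inter> Y"
      then obtain v where v: "v \<in> \<Union>E" "w = \<phi> c v" "w \<in> Y" unfolding UD by blast
      then show "w \<in> c" using \<phi>Y[OF c v(1)] \<beta>c[OF c v(1)] by (simp add: \<phi>_def)
    qed
    show "card (e \<inter> Y) \<le> 1" if e: "e \<in> D c" for e
    proof -
      have "e \<in> E'" using e c by (auto simp: E'_def)
      then have "inj_on p' (e \<inter> Y)" using tr by (meson transversal_def inj_on_subset inf_le1)
      moreover have "p' ` (e \<inter> Y) \<subseteq> {i}" by (auto simp: p'_def)
      ultimately show ?thesis
        using card_inj_on_le[of p' "e \<inter> Y" "{i}"] by simp
    qed
    show "\<Union>(D c) \<inter> \<Union>(D d) \<subseteq> Y" if d: "d \<in> J" "c \<noteq> d" for d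
    proof
      fix w assume "w \<in> \<Union>(D c) \<inter> \<Union>(D d)"
      then obtain u v where uv: "u \<in> \<Union>E" "w = \<phi> c u" "v \<in> \<Union>E" "w = \<phi> d v" unfolding UD by blast
      have "set_encode c \<noteq> set_encode d"
        using d c finc set_encode_inverse by metis
      then show "w \<in> Y"
        using uv \<phi>Y[OF c uv(1)] \<phi>Y[OF d(1) uv(3)] by (auto simp: \<phi>_def split: if_splits)
    qed
  qed
  have "partite_forces_mono m (Suc i) p' E'"
    unfolding partite_forces_mono_def
  proof (intro allI impI, elim conjE)
    fix \<chi> f :: "nat \<Rightarrow> nat"
    assume \<chi>: "\<forall>v. \<chi> v < m" and f: "\<forall>j. f j < m" and \<chi>f: "\<forall>v\<in>\<Union>E'. Suc i \<le> p' v \<longrightarrow> \<chi> v = f (p' v)"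
    have "\<forall>y. (\<chi> \<circ> \<epsilon>) y < m" using \<chi> by simp
    then obtain c0 d where cd: "c0 \<in> H" "d < m" "\<forall>y\<in>c0. (\<chi> \<circ> \<epsilon>) y = d"
      using forces_monoD[OF H(3), of "\<chi> \<circ> \<epsilon>"] by blast
    define c where "c = \<epsilon> ` c0"
    have c: "c \<in> J" "\<forall>y\<in>c. \<chi> y = d" using cd by (auto simp: c_def J_def)
    \<comment> \<open>The coloring as seen in the copy over \<open>c\<close>: part \<open>i\<close>
      has the constant color \<open>d\<close>, and later parts keep the colors prescribed by
      \<open>f\<close>.\<close>
    have "\<forall>v\<in>\<Union>E. i \<le> p v \<longrightarrow> (\<chi> \<circ> \<phi> c) v = (f(i := d)) (p v)"
    proof (intro ballI impI)
      fix v assume v: "v \<in> \<Union>E" "i \<le> p v"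
      show "(\<chi> \<circ> \<phi> c) v = (f(i := d)) (p v)"
      proof (cases "p v = i")
        case True
        then show ?thesis using c \<beta>c[OF c(1) v(1)] by (simp add: \<phi>_def)
      next
        case False
        have "\<phi> c v \<in> \<Union>E'" using v(1) c(1) by (auto simp: E'_def D_def)
        then have "\<chi> (\<phi> c v) = f (p' (\<phi> c v))"
          using \<chi>f False v(2) p'\<phi>[OF c(1) v(1)] by (metis Suc_leI le_neq_implies_less)
        then show ?thesis using False p'\<phi>[OF c(1) v(1)] by simp
      qed
    qed
    moreover have "\<forall>v. (\<chi> \<circ> \<phi> c) v < m" "\<forall>j. (f(i := d)) j < m" using \<chi> f cd(2) by auto
    ultimately obtain e d' where "e \<in> E" "d' < m" "\<forall>v\<in>e. (\<chi> \<circ> \<phi> c) v = d'"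
      using partite_forces_monoD[OF E(4), of "\<chi> \<circ> \<phi> c" "f(i := d)"] by blast
    then show "\<exists>e\<in>E'. \<exists>d<m. \<forall>v\<in>e. \<chi> v = d"
      using c(1) by (intro bexI[of _ "\<phi> c ` e"]) (auto simp: E'_def D_def)
  qed
  with fin tr sp show thesis by (rule that)
qed

text \<open>One amalgamation step per part. Only \<open>g div 2\<close> is demanded of
  \<open>H\<close>, but for every edge size \<open>r\<close>, since the size of the part to be
  replaced is not controlled.\<close>

lemma sparse_transversal_forces_mono:
  assumes "finite Q" "\<And>q. q \<in> Q \<Longrightarrow> finite q" "forces_mono m Q"
    and uniform: "\<And>r. \<exists>H :: nat set set.
      finite (\<Union>H) \<and> sparse (g div 2) H \<and> forces_mono m H \<and> (\<forall>c\<in>H. card c = r)"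
  obtains E :: "nat set set" and p where "finite (\<Union>E)" "transversal p Q E" "sparse g E"
    "forces_mono m E"
proof -
  have step: "\<exists>(E :: nat set set) p.
      finite (\<Union>E) \<and> transversal p Q E \<and> sparse g E \<and> partite_forces_mono m i p E" for i
  proof (induction i)
    case 0
    show ?case using partite_base[OF assms(1-3)] by metis
  next
    case (Suc i)
    then obtain E :: "nat set set" and p where
      E: "finite (\<Union>E)" "transversal p Q E" "sparse g E" "partite_forces_mono m i p E" by blast
    obtain H :: "nat set set" where "finite (\<Union>H)" "sparse (g div 2) H" "forces_mono m H"
      "\<forall>c\<in>H. card c = card {v \<in> \<Union>E. p v = i}" using uniform by blast
    then show ?case using partite_step[OF E, of H] by metis
  qed
  have "finite (\<Union>Q)" using assms by auto
  then obtain a where a: "\<Union>Q \<subseteq> {..<a}" by (meson finite_nat_iff_bounded)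
  obtain E :: "nat set set" and p where
    E: "finite (\<Union>E)" "transversal p Q E" "sparse g E" "partite_forces_mono m a p E" using step by blast
  \<comment> \<open>All parts are below \<open>a\<close>, so after \<open>a\<close> steps the
    constancy condition concerns no vertex.\<close>
  have small: "\<not> a \<le> p v" if "v \<in> \<Union>E" for v
    using that E(2) a unfolding transversal_def by (fastforce simp: not_le)
  have "forces_mono m E"
    unfolding forces_mono_def
  proof (intro allI impI)
    fix \<chi> :: "nat \<Rightarrow> nat" assume "\<forall>v. \<chi> v < m"
    \<comment> \<open>The second \<open>\<chi>\<close> fills the place of \<open>f\<close>, of which
      only values below \<open>m\<close> are asked here.\<close>
    then show "\<exists>e\<in>E. \<exists>d<m. \<forall>v\<in>e. \<chi> v = d"
      using partite_forces_monoD[OF E(4), of \<chi> \<chi>] small by blast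
  qed
  with E show thesis by (intro that)
qed

section \<open>Sparse uniform hypergraphs with prescribed color classes\<close>

lemma pigeonhole_fibre:
  fixes f :: "'a \<Rightarrow> nat"
  assumes "finite A" "\<And>x. x \<in> A \<Longrightarrow> f x < m" "m * r < card A"
  obtains d where "d < m" "r < card {x \<in> A. f x = d}"
proof (rule ccontr)
  assume "\<not> thesis"
  then have le: "card {x \<in> A. f x = d} \<le> r" if "d < m" for d
    using that \<open>\<And>d. \<lbrakk>d < m; r < card {x \<in> A. f x = d}\<rbrakk> \<Longrightarrow> thesis\<close> not_less by blast
  have "A = (\<Union>d<m. {x \<in> A. f x = d})" using assms(2) by auto
  then have "card A \<le> (\<Sum>d<m. card {x \<in> A. f x = d})"
    using card_UN_le[of "{..<m}" "\<lambda>d. {x \<in> A. f x = d}"] by simp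
  also have "\<dots> \<le> (\<Sum>d<m. r)" using le by (intro sum_mono) auto
  finally show False using assms(3) by simp
qed

lemma forces_mono_complete: "forces_mono m {q. q \<subseteq> {..<m * r + 1} \<and> card q = r}"
  unfolding forces_mono_def
proof (intro allI impI)
  fix \<chi> :: "nat \<Rightarrow> nat" assume "\<forall>v. \<chi> v < m"
  then obtain d where d: "d < m" "r < card {x \<in> {..<m * r + 1}. \<chi> x = d}"
    using pigeonhole_fibre[of "{..<m * r + 1}" \<chi> m r] by auto
  then obtain q where "q \<subseteq> {x \<in> {..<m * r + 1}. \<chi> x = d}" "card q = r"
    using obtain_subset_with_card_n[OF less_imp_le[OF d(2)]] by metis
  then show "\<exists>e\<in>{q. q \<subseteq> {..<m * r + 1} \<and> card q = r}. \<exists>d<m. \<forall>v\<in>e. \<chi> v = d"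
    using d(1) by (intro bexI[of _ q]) auto
qed

text \<open>Induction on \<open>g\<close> by halving: amalgamation over a complete
  \<open>r\<close>-uniform system uses auxiliary hypergraphs only for \<open>g div 2\<close>, but of
  any uniformity, hence the generalization over \<open>r\<close>. For \<open>g = 0\<close>, where
  halving gives nothing smaller, sparsity is void and the complete system itself serves.\<close>

lemma sparse_uniform_forces_mono:
  "\<exists>H :: nat set set. finite (\<Union>H) \<and> sparse g H \<and> forces_mono m H \<and> (\<forall>c\<in>H. card c = r)"
proof (induction g arbitrary: r rule: less_induct)
  case (less g)
  define Q where "Q = {q. q \<subseteq> {..<m * r + 1} \<and> card q = r}"
  have Q: "finite Q" "\<And>q. q \<in> Q \<Longrightarrow> finite q" "forces_mono m Q" "\<forall>q\<in>Q. card q = r"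
    using forces_mono_complete by (auto simp: Q_def finite_subset)
  show ?case
  proof (cases "g = 0")
    case True
    have "finite (\<Union>Q)" using Q by auto
    then show ?thesis using Q True sparse_zero by blast
  next
    case False
    then obtain E :: "nat set set" and p where
      E: "finite (\<Union>E)" "transversal p Q E" "sparse g E" "forces_mono m E"
      using sparse_transversal_forces_mono[OF Q(1-3) less.IH[of "g div 2"]] by auto
    have "card c = r" if "c \<in> E" for c
      using that E(2) Q(4) unfolding transversal_def by (metis card_image)
    then show ?thesis using E by blast
  qed
qed

text \<open>
  Part \<open>prod_encode (t, u)\<close> belongs to the color class \<open>t\<close> of the intended coloring. With only \<open>m\<close>
  colors two of the \<open>m + 1\<close> classes share a frequent color.
\<close>

lemma forces_mono_two_classes:
  fixes m n :: nat
  assumes "3 \<le> n"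
  defines "Q \<equiv> {q. q \<subseteq> prod_encode ` ({..m} \<times> {..m * n}) \<and> card q = n \<and>
             \<not> inj_on (fst \<circ> prod_decode) q \<and> \<not> (\<exists>d. \<forall>j\<in>q. fst (prod_decode j) = d)}"
  shows "forces_mono m Q"
  unfolding forces_mono_def
proof (intro allI impI)
  fix \<chi> :: "nat \<Rightarrow> nat" assume \<chi>: "\<forall>v. \<chi> v < m"
  have "\<exists>d<m. n < card {u \<in> {..m * n}. \<chi> (prod_encode (t, u)) = d}" for t
  proof -
    have "m * n < card {..m * n}" by simp
    then obtain d where "d < m" "n < card {u \<in> {..m * n}. \<chi> (prod_encode (t, u)) = d}"
      using pigeonhole_fibre[of "{..m * n}" "\<lambda>u. \<chi> (prod_encode (t, u))" m n] \<chi> by blast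
    then show ?thesis by blast
  qed
  then obtain d where d: "\<And>t. d t < m"
    "\<And>t. n < card {u \<in> {..m * n}. \<chi> (prod_encode (t, u)) = d t}" by metis
  have "\<not> inj_on d {..m}"
  proof
    assume "inj_on d {..m}"
    then have "card {..m} \<le> card {..<m}"
      using d(1) by (intro card_inj_on_le) auto
    then show False by simp
  qed
  then obtain s t where st: "s \<le> m" "t \<le> m" "s \<noteq> t" "d s = d t" by (auto simp: inj_on_def)
  \<comment> \<open>The edge will consist of \<open>n - 1\<close> vertices of class \<open>s\<close>
    and one of class \<open>t\<close>, all of color \<open>d s\<close>. As \<open>n \<ge> 3\<close>,
    class \<open>s\<close> occurs at least twice, so the classes are neither all distinct nor all
    equal on it.\<close>
  obtain A where A: "A \<subseteq> {u \<in> {..m * n}. \<chi> (prod_encode (s, u)) = d s}" "card A = n - 1"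
  proof -
    have "n - 1 \<le> card {u \<in> {..m * n}. \<chi> (prod_encode (s, u)) = d s}"
      using d(2)[of s] by linarith
    then show thesis by (rule obtain_subset_with_card_n) (rule that)
  qed
  have finA: "finite A" using A(1) finite_subset by fastforce
  obtain b where b: "b \<le> m * n" "\<chi> (prod_encode (t, b)) = d t"
  proof -
    have "{u \<in> {..m * n}. \<chi> (prod_encode (t, u)) = d t} \<noteq> {}"
      using d(2)[of t] by (metis card.empty not_less_zero)
    then show thesis using that by blast
  qed
  define q where "q = insert (prod_encode (t, b)) ((\<lambda>u. prod_encode (s, u)) ` A)"
  have "card ((\<lambda>u. prod_encode (s, u)) ` A) = n - 1"
    using A(2) by (subst card_image) (auto simp: inj_on_def)
  moreover have "prod_encode (t, b) \<notin> (\<lambda>u. prod_encode (s, u)) ` A" using st(3) by auto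
  ultimately have cq: "card q = n" using finA assms(1) by (simp add: q_def)
  have "\<not> card A \<le> 1" using A(2) assms(1) by simp
  then obtain x y where xy: "x \<in> A" "y \<in> A" "x \<noteq> y"
    using finA by (metis card_le_Suc0_iff_eq One_nat_def)
  have "prod_encode (s, x) \<in> q" "prod_encode (s, y) \<in> q"
    "(fst \<circ> prod_decode) (prod_encode (s, x)) = (fst \<circ> prod_decode) (prod_encode (s, y))"
    "prod_encode (s, x) \<noteq> prod_encode (s, y)"
    using xy by (auto simp: q_def)
  then have "\<not> inj_on (fst \<circ> prod_decode) q" by (meson inj_onD)
  moreover have "\<not> (\<exists>d. \<forall>j\<in>q. fst (prod_decode j) = d)"
    using xy(1) st(3) by (auto simp: q_def)
  moreover have "q \<subseteq> prod_encode ` ({..m} \<times> {..m * n})"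
    using A(1) b(1) st by (auto simp: q_def)
  ultimately have "q \<in> Q" using cq by (simp add: Q_def)
  moreover have "\<forall>v\<in>q. \<chi> v = d s" using A(1) b(2) st(4) by (auto simp: q_def)
  ultimately show "\<exists>e\<in>Q. \<exists>d<m. \<forall>v\<in>e. \<chi> v = d" using d(1) by blast
qed

lemma sparse_bicolored_hypergraph:
  assumes "3 \<le> n"
  obtains E :: "nat set set" and \<kappa> :: "nat \<Rightarrow> nat"
  where "finite (\<Union>E)" "sparse g E" "forces_mono m E" "\<And>e. e \<in> E \<Longrightarrow> card e = n"
    "\<kappa> ` \<Union>E \<subseteq> {..m}" "\<And>e. e \<in> E \<Longrightarrow> \<not> inj_on \<kappa> e" "\<And>e d. e \<in> E \<Longrightarrow> \<not> (\<forall>v\<in>e. \<kappa> v = d)"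
proof -
  define Q where "Q = {q. q \<subseteq> prod_encode ` ({..m} \<times> {..m * n}) \<and> card q = n \<and>
             \<not> inj_on (fst \<circ> prod_decode) q \<and> \<not> (\<exists>d. \<forall>j\<in>q. fst (prod_decode j) = d)}"
  have Q: "finite Q" "\<And>q. q \<in> Q \<Longrightarrow> finite q" "forces_mono m Q"
    using forces_mono_two_classes[OF assms] by (auto simp: Q_def intro: finite_subset)
  obtain E :: "nat set set" and p where
    E: "finite (\<Union>E)" "transversal p Q E" "sparse g E" "forces_mono m E"
    using sparse_transversal_forces_mono[OF Q sparse_uniform_forces_mono] by blast
  \<comment> \<open>The color of a vertex depends on its part only, so transversality carries the
    color pattern from the members of \<open>Q\<close> to the edges.\<close>
  define \<kappa> where "\<kappa> v = fst (prod_decode (p v))" for v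
  have e: "inj_on p e" "p ` e \<subseteq> prod_encode ` ({..m} \<times> {..m * n})" "card (p ` e) = n"
    "\<not> inj_on (fst \<circ> prod_decode) (p ` e)" "\<not> (\<exists>d. \<forall>j\<in>p ` e. fst (prod_decode j) = d)"
    if "e \<in> E" for e
    using E(2) that unfolding transversal_def Q_def by auto
  show thesis
  proof (rule that[OF E(1,3,4)])
    show "\<kappa> ` \<Union>E \<subseteq> {..m}"
      using e(2) by (fastforce simp: \<kappa>_def)
  next
    fix e assume eE: "e \<in> E"
    show "card e = n" using e(1,3)[OF eE] card_image by metis
    show "\<not> inj_on \<kappa> e"
      using e(4)[OF eE] by (auto simp: inj_on_def \<kappa>_def)
    show "\<not> (\<forall>v\<in>e. \<kappa> v = d)" for d
      using e(5)[OF eE] by (auto simp: \<kappa>_def)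
  qed
qed

section \<open>Planting a 2-connected graph\<close>

lemma connected_crossing_arc:
  assumes "connected G" "a \<in> verts G" "b \<in> verts G" "a \<in> S" "b \<notin> S"
  shows "\<exists>u v. (u, v) \<in> (arcs_ends G)\<^sup>s \<and> u \<in> verts G \<and> v \<in> verts G \<and> u \<in> S \<and> v \<notin> S"
proof (rule ccontr)
  assume "\<not> ?thesis"
  then have stay: "v \<in> S" if "(u, v) \<in> (arcs_ends G)\<^sup>s" "u \<in> verts G" "v \<in> verts G" "u \<in> S" for u v
    using that by blast
  have "(a, b) \<in> rtrancl_on (verts G) ((arcs_ends G)\<^sup>s)"
    using assms(1-3) by (simp add: connected_conv)
  then have "b \<in> S"
    by (induction rule: rtrancl_on_induct) (use assms(4) stay in blast)+
  then show False using assms(5) by simp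
qed

text \<open>Deleting the common vertex, if there is one, leaves a connected graph. If both sides had
  private vertices, some arc would have to lead directly from \<open>A - B\<close> to
  \<open>B - A\<close>.\<close>

lemma two_connected_no_separation:
  fixes F :: "'a pair_pre_digraph"
  assumes F: "pair_graph F" "two_connected F"
    and AB: "A \<union> B = pverts F" "card (A \<inter> B) \<le> 1"
    and sep: "\<And>u v. (u, v) \<in> parcs F \<Longrightarrow> u \<in> A - B \<Longrightarrow> v \<in> B - A \<Longrightarrow> False"
  shows "A \<subseteq> B \<or> B \<subseteq> A"
proof (rule ccontr)
  assume "\<not> ?thesis"
  then obtain a b where ab: "a \<in> A - B" "b \<in> B - A" by blast
  interpret pair_graph F by fact
  have "finite (A \<inter> B)"
    using AB(1) pair_finite_verts by (metis finite_Int finite_Un)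
  have "\<exists>G :: ('a, 'a \<times> 'a) pre_digraph.
    connected G \<and> verts G = pverts F - (A \<inter> B) \<and> arcs_ends G \<subseteq> parcs F"
  proof (cases "A \<inter> B = {}")
    case True
    then show ?thesis using F(2) by (intro exI[of _ "with_proj F"]) (simp add: two_connected_def)
  next
    case False
    then have "card (A \<inter> B) = 1"
      using AB(2) \<open>finite (A \<inter> B)\<close> by (metis One_nat_def card_gt_0_iff le_antisym Suc_leI)
    then obtain x where x: "A \<inter> B = {x}" by (rule card_1_singletonE)
    then have "x \<in> pverts F" using AB(1) by auto
    then have "connected (pre_digraph.del_vert (with_proj F) x)"
      using F(2) by (simp add: two_connected_def)
    moreover have "verts (pre_digraph.del_vert (with_proj F) x) = pverts F - (A \<inter> B)"
      by (simp add: x pre_digraph.verts_del_vert)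
    moreover have "arcs_ends (pre_digraph.del_vert (with_proj F) x) \<subseteq> parcs F"
      by (auto simp: arcs_ends_conv pre_digraph.arcs_del_vert pre_digraph.tail_del_vert
          pre_digraph.head_del_vert)
    ultimately show ?thesis by blast
  qed
  then obtain G :: "('a, 'a \<times> 'a) pre_digraph" where
    G: "connected G" "verts G = pverts F - (A \<inter> B)" "arcs_ends G \<subseteq> parcs F"
    by blast
  obtain u v where uv: "(u, v) \<in> (arcs_ends G)\<^sup>s" "u \<in> verts G" "v \<in> verts G"
    "u \<in> A - B" "v \<notin> A - B"
    using connected_crossing_arc[OF G(1), of a b "A - B"] ab G(2) AB(1) by blast
  have "(u, v) \<in> parcs F"
    using uv(1) G(3) arcs_symmetric by (auto simp: symcl_def)
  moreover have "v \<in> B - A" using uv(3,5) G(2) AB(1) by auto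
  ultimately show False using sep uv(4) by blast
qed

section \<open>Copies of \<open>F\<close> and the planted graph\<close>

lemma digraph_iso_with_projE:
  assumes "digraph_iso (with_proj F) (with_proj H)"
  obtains f where "inj_on f (pverts F)" "pverts H = f ` pverts F"
    "parcs H = map_prod f f ` parcs F"
proof -
  obtain h where h: "pre_digraph.digraph_isomorphism (with_proj F) h" "with_proj H = app_iso h (with_proj F)"
    using assms by (auto simp: digraph_iso_def)
  \<comment> \<open>An isomorphism brings its own arc, head and tail maps. As both digraphs use the
    projections \<open>fst\<close> and \<open>snd\<close>, the arc map is forced by the vertex
    map.\<close>
  have t: "iso_tail h = fst" "iso_head h = snd"
    using arg_cong[OF h(2), of tail] arg_cong[OF h(2), of head] by simp_all
  have "iso_arcs h a = map_prod (iso_verts h) (iso_verts h) a" if "a \<in> parcs F" for a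
    using h(1) that t by (auto simp: pre_digraph.digraph_isomorphism_def prod_eq_iff)
  then have "parcs H = map_prod (iso_verts h) (iso_verts h) ` parcs F"
    using arg_cong[OF h(2), of arcs] by simp
  moreover have "pverts H = iso_verts h ` pverts F"
    using arg_cong[OF h(2), of verts] by simp
  moreover have "inj_on (iso_verts h) (pverts F)"
    using h(1) by (auto simp: pre_digraph.digraph_isomorphism_def)
  ultimately show thesis by (intro that)
qed

lemma digraph_iso_image:
  assumes "pair_graph F" "inj_on f (pverts F)"
  defines "H \<equiv> \<lparr>pverts = f ` pverts F, parcs = map_prod f f ` parcs F\<rparr>"
  shows "pair_graph H" "digraph_iso (with_proj F) (with_proj H)"
proof -
  interpret pair_graph F by fact
  show "pair_graph H"
  proof
    show "symmetric (with_proj H)"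
      by (auto simp: H_def symmetric_def sym_def intro: arcs_symmetric)
    show "e \<in> parcs H \<Longrightarrow> fst e \<noteq> snd e" for e
      using assms(2) no_loops' wellformed' by (fastforce simp: H_def dest: inj_onD)
  qed (auto simp: H_def wellformed')
  define h where "h = \<lparr>iso_verts = f, iso_arcs = map_prod f f, iso_head = snd, iso_tail = fst\<rparr>"
  have "inj_on (map_prod f f) (parcs F)"
  proof (rule inj_onI)
    fix a b assume "a \<in> parcs F" "b \<in> parcs F" "map_prod f f a = map_prod f f b"
    then show "a = b"
      using assms(2) wellformed' by (cases a, cases b) (auto dest: inj_onD)
  qed
  then have "pre_digraph.digraph_isomorphism (with_proj F) h"
    using assms(2) wf_digraph by (auto simp: pre_digraph.digraph_isomorphism_def h_def)
  moreover have "with_proj H = app_iso h (with_proj F)"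
    by (simp add: with_proj_def app_iso_def H_def h_def)
  ultimately show "digraph_iso (with_proj F) (with_proj H)"
    unfolding digraph_iso_def by blast
qed

definition planted :: "'a pair_pre_digraph \<Rightarrow> ('b set \<Rightarrow> 'a \<Rightarrow> 'b) \<Rightarrow> 'b set set \<Rightarrow> 'b pair_pre_digraph" where
  "planted F \<sigma> E = \<lparr>pverts = \<Union>E, parcs = (\<Union>e\<in>E. map_prod (\<sigma> e) (\<sigma> e) ` parcs F)\<rparr>"

lemma pair_graph_planted:
  assumes "pair_graph F" "finite (\<Union>E)" "\<And>e. e \<in> E \<Longrightarrow> bij_betw (\<sigma> e) (pverts F) e"
  shows "pair_graph (planted F \<sigma> E)"
proof -
  interpret pair_graph F by fact
  have mem: "\<sigma> e u \<in> e" if "e \<in> E" "u \<in> pverts F" for e u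
    using assms(3)[OF that(1)] that(2) by (auto dest: bij_betwE)
  have neq: "\<sigma> e u \<noteq> \<sigma> e v" if "e \<in> E" "(u, v) \<in> parcs F" for e u v
    using bij_betw_imp_inj_on[OF assms(3)[OF that(1)]] that(2) no_loops' wellformed'
    by (meson inj_onD)
  have arc: "\<exists>e\<in>E. \<exists>u v. (u, v) \<in> parcs F \<and> a = (\<sigma> e u, \<sigma> e v)"
    if "a \<in> parcs (planted F \<sigma> E)" for a
    using that by (auto simp: planted_def)
  have "finite E" using assms(2) by (rule finite_UnionD)
  show ?thesis
  proof
    fix a assume "a \<in> parcs (planted F \<sigma> E)"
    then obtain e u v where a: "e \<in> E" "(u, v) \<in> parcs F" "a = (\<sigma> e u, \<sigma> e v)"
      using arc by blast
    then have "\<sigma> e u \<in> e" "\<sigma> e v \<in> e" using mem wellformed' by auto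
    then show "fst a \<in> pverts (planted F \<sigma> E)" "snd a \<in> pverts (planted F \<sigma> E)"
      using a by (auto simp: planted_def)
    show "fst a \<noteq> snd a" using neq a by simp
  next
    show "symmetric (with_proj (planted F \<sigma> E))"
      unfolding symmetric_def
    proof (rule symI)
      fix x y assume "(x, y) \<in> arcs_ends (with_proj (planted F \<sigma> E))"
      then have "(x, y) \<in> parcs (planted F \<sigma> E)" by simp
      then obtain e u v where a: "e \<in> E" "(u, v) \<in> parcs F" "(x, y) = (\<sigma> e u, \<sigma> e v)"
        using arc by blast
      then have "(y, x) = map_prod (\<sigma> e) (\<sigma> e) (v, u)" "(v, u) \<in> parcs F"
        using arcs_symmetric by auto
      then have "(y, x) \<in> map_prod (\<sigma> e) (\<sigma> e) ` parcs F" by (rule image_eqI)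
      then show "(y, x) \<in> arcs_ends (with_proj (planted F \<sigma> E))"
        using a(1) by (auto simp: planted_def)
    qed
  qed (use assms(2) \<open>finite E\<close> pair_finite_arcs in \<open>auto simp: planted_def\<close>)
qed

text \<open>The arcs of the copy are grouped by hyperedges containing them; there are at most
  \<open>card (parcs F)\<close> groups, hence the choice of the girth parameter. Some group shares
  at most one vertex with the others, so by 2-connectedness it contains all vertices of the copy,
  and its hyperedge has the same size as \<open>F\<close>.\<close>

lemma copy_in_planted:
  assumes F: "pair_graph F" "two_connected F"
    and E: "finite (\<Union>E)" "sparse (card (parcs F)) E" "\<And>e. e \<in> E \<Longrightarrow> bij_betw (\<sigma> e) (pverts F) e"
    and H: "pair_graph H" "subgraph (with_proj H) (with_proj (planted F \<sigma> E))"
      "digraph_iso (with_proj F) (with_proj H)"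
  shows "pverts H \<in> E"
proof -
  interpret F: pair_graph F by fact
  interpret H: pair_graph H by fact
  obtain f where f: "inj_on f (pverts F)" "pverts H = f ` pverts F" "parcs H = map_prod f f ` parcs F"
    using H(3) by (rule digraph_iso_with_projE)
  have card3: "3 \<le> card (pverts F)" using F(2) by (simp add: two_connected_def)
  \<comment> \<open>The absence of a separation is carried over from \<open>F\<close> to
    \<open>H\<close> along \<open>f\<close>.\<close>
  have noSep: "A \<subseteq> B \<or> B \<subseteq> A"
    if AB: "A \<union> B = pverts H" "card (A \<inter> B) \<le> 1"
      and sep: "\<And>u v. (u, v) \<in> parcs H \<Longrightarrow> u \<in> A - B \<Longrightarrow> v \<in> B - A \<Longrightarrow> False" for A B
  proof -
    define A' where "A' = pverts F \<inter> f -` A"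
    define B' where "B' = pverts F \<inter> f -` B"
    have "A \<subseteq> f ` pverts F" "B \<subseteq> f ` pverts F" using AB(1) f(2) by auto
    then have im: "f ` A' = A" "f ` B' = B" "f ` (A' \<inter> B') = A \<inter> B"
      unfolding A'_def B'_def by fast+
    have "A' \<union> B' = pverts F" using AB(1) f(2) by (auto simp: A'_def B'_def)
    moreover have "card (A' \<inter> B') \<le> 1"
    proof -
      have "inj_on f (A' \<inter> B')" by (rule inj_on_subset[OF f(1)]) (auto simp: A'_def)
      then show ?thesis using AB(2) im(3) card_image[of f "A' \<inter> B'"] by simp
    qed
    moreover have False if "(u, v) \<in> parcs F" "u \<in> A' - B'" "v \<in> B' - A'" for u v
    proof (rule sep)
      show "(f u, f v) \<in> parcs H" using f(3) that(1) by force
    qed (use that in \<open>auto simp: A'_def B'_def\<close>)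
    ultimately have "A' \<subseteq> B' \<or> B' \<subseteq> A'"
      by (rule two_connected_no_separation[OF F])
    then show ?thesis using im by blast
  qed
  have "\<exists>e. e \<in> E \<and> fst a \<in> e \<and> snd a \<in> e" if "a \<in> parcs H" for a
  proof -
    have "a \<in> parcs (planted F \<sigma> E)" using H(2) that by (auto simp: subgraph_def)
    then obtain e b where "e \<in> E" "b \<in> parcs F" "a = map_prod (\<sigma> e) (\<sigma> e) b"
      by (auto simp: planted_def)
    then show ?thesis
      using bij_betwE[OF E(3)[of e]] F.wellformed' by (cases b) auto
  qed
  then obtain h where h: "\<And>a. a \<in> parcs H \<Longrightarrow> h a \<in> E \<and> fst a \<in> h a \<and> snd a \<in> h a" by metis
  define C where "C = h ` parcs H"
  define T where "T e = (\<Union>a\<in>{a \<in> parcs H. h a = e}. {fst a, snd a})" for e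
  have cC: "card C \<le> card (parcs F)"
    using f(3) F.pair_finite_arcs H.pair_finite_arcs
    by (metis C_def card_image_le le_trans)
  \<comment> \<open>This makes \<open>C\<close> nonempty: without arcs, a single vertex could be
    split off.\<close>
  have "parcs H \<noteq> {}"
  proof
    assume no: "parcs H = {}"
    obtain x where x: "x \<in> pverts H" using card3 f(2) by fastforce
    have "{x} \<subseteq> pverts H - {x} \<or> pverts H - {x} \<subseteq> {x}"
      by (rule noSep) (use x no in auto)
    then have "pverts H \<subseteq> {x}" by blast
    then have "card (pverts H) \<le> 1" using card_mono[of "{x}" "pverts H"] by simp
    then show False using card3 f(1,2) by (simp add: card_image)
  qed
  have Te: "T e \<subseteq> e" "finite (T e)" for e
    using h H.pair_finite_arcs by (auto simp: T_def)
  have C: "C \<subseteq> E" "finite C" "C \<noteq> {}"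
    using h H.pair_finite_arcs \<open>parcs H \<noteq> {}\<close> by (auto simp: C_def)
  obtain e where e: "e \<in> C" "card (T e \<inter> (\<Union>d\<in>C-{e}. T d)) \<le> 1"
    by (rule sparse_leaf[OF E(2) C cC Te])
  define O' where "O' = (\<Union>d\<in>C-{e}. T d)"
  \<comment> \<open>The rest of \<open>H\<close> together with the vertices that \<open>T e\<close>
    shares with other traces. Taking a complement puts a vertex without arcs into \<open>B\<close>,
    so that \<open>T e\<close> and \<open>B\<close> cover \<open>H\<close> in any case.\<close>
  define B where "B = (pverts H - T e) \<union> (T e \<inter> O')"
  have "T e \<subseteq> pverts H" using H.wellformed' by (auto simp: T_def)
  have "T e \<subseteq> B \<or> B \<subseteq> T e"
  proof (rule noSep)
    show "T e \<union> B = pverts H" using \<open>T e \<subseteq> pverts H\<close> by (auto simp: B_def)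
    have "T e \<inter> B = T e \<inter> O'" by (auto simp: B_def)
    then show "card (T e \<inter> B) \<le> 1" using e(2) by (simp add: O'_def)
    fix u v assume uv: "(u, v) \<in> parcs H" "u \<in> T e - B" "v \<in> B - T e"
    \<comment> \<open>An arc grouped under \<open>e\<close> has both ends in \<open>T e\<close>; any
      other arc has both ends in \<open>O'\<close>.\<close>
    have "u \<in> T (h (u, v))" "v \<in> T (h (u, v))" "h (u, v) \<in> C" using uv(1) by (auto simp: T_def C_def)
    then show False using uv(2,3) by (cases "h (u, v) = e") (auto simp: B_def O'_def)
  qed
  moreover have "\<not> T e \<subseteq> B"
  proof
    assume "T e \<subseteq> B"
    then have "T e \<inter> O' = T e" by (auto simp: B_def)
    then have "card (T e) \<le> 1" using e(2) by (simp add: O'_def)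
    obtain a where a: "a \<in> parcs H" "h a = e" using e(1) by (auto simp: C_def)
    then have "{fst a, snd a} \<subseteq> T e" unfolding T_def by blast
    then have "card {fst a, snd a} \<le> card (T e)" by (rule card_mono[OF Te(2)])
    then show False using \<open>card (T e) \<le> 1\<close> H.pair_no_loops[OF a(1)] by simp
  qed
  ultimately have "pverts H \<subseteq> e" using Te(1) by (auto simp: B_def)
  have eE: "e \<in> E" using e(1) h by (auto simp: C_def)
  have "card e = card (pverts H)"
    using f(1,2) bij_betw_same_card[OF E(3)[OF eE]] by (simp add: card_image)
  moreover have "finite e" using E(1) eE by (meson Union_upper finite_subset)
  ultimately have "pverts H = e" using \<open>pverts H \<subseteq> e\<close> by (intro card_subset_eq) auto
  then show ?thesis using eE by simp
qed

lemma planted_copy: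
  assumes "pair_graph F" "finite (\<Union>E)" "\<And>e. e \<in> E \<Longrightarrow> bij_betw (\<sigma> e) (pverts F) e" "e \<in> E"
  obtains H where "pair_graph H" "subgraph (with_proj H) (with_proj (planted F \<sigma> E))"
    "digraph_iso (with_proj F) (with_proj H)" "pverts H = e"
proof -
  let ?H = "\<lparr>pverts = \<sigma> e ` pverts F, parcs = map_prod (\<sigma> e) (\<sigma> e) ` parcs F\<rparr>"
  have b: "inj_on (\<sigma> e) (pverts F)" "\<sigma> e ` pverts F = e"
    using assms(3,4) by (auto simp: bij_betw_def)
  note H = digraph_iso_image[OF assms(1) b(1)]
  interpret H: pair_graph ?H by (rule H(1))
  interpret G: pair_graph "planted F \<sigma> E" by (rule pair_graph_planted[OF assms(1-3)])
  have "subgraph (with_proj ?H) (with_proj (planted F \<sigma> E))"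
    using H.wf_digraph G.wf_digraph assms(4) b(2)
    by (auto simp: subgraph_def planted_def compatibleI_with_proj)
  then show thesis using H b(2) by (intro that[of ?H]) auto
qed

section \<open>Determining the minimum number of colors\<close>

lemma W_minus_eqI:
  assumes "worm_coloring G F (c :: 'a \<Rightarrow> nat)" "card (c ` pverts G) \<le> k"
    and "\<And>c' :: 'a \<Rightarrow> nat. worm_coloring G F c' \<Longrightarrow> k \<le> card (c' ` pverts G)"
  shows "W_minus G F = k"
  unfolding W_minus_def
proof (rule Least_equality)
  have "card (c ` pverts G) = k" using assms(2) assms(3)[OF assms(1)] by simp
  then show "\<exists>c :: 'a \<Rightarrow> nat. worm_coloring G F c \<and> card (c ` pverts G) = k"
    using assms(1) by blast
qed (use assms(3) in blast)

theorem theorem1: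
  fixes F :: "'a pair_pre_digraph" and k :: nat
  assumes "pair_graph F" and "two_connected F" and "k > 0"
  shows "\<exists>G :: nat pair_pre_digraph.
    pair_graph G \<and> worm_colorable G F \<and> W_minus G F = k"
proof (cases "k = 1")
  case True
  \<comment> \<open>For \<open>k = 1\<close> the hypergraph would be useless, since
    \<open>m = 0\<close> forces nothing. A single vertex leaves no room for a copy of
    \<open>F\<close>.\<close>
  define G :: "nat pair_pre_digraph" where "G = \<lparr>pverts = {0}, parcs = {}\<rparr>"
  have "pair_graph G" by unfold_locales (auto simp: G_def symmetric_def sym_def)
  moreover have worm: "worm_coloring G F (c :: nat \<Rightarrow> nat)" for c
    unfolding worm_coloring_def
  proof (intro allI impI, elim conjE)
    fix H :: "nat pair_pre_digraph"
    assume "subgraph (with_proj H) (with_proj G)" "digraph_iso (with_proj F) (with_proj H)"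
    then have "pverts H \<subseteq> {0}" "card (pverts H) = card (pverts F)"
      by (auto simp: subgraph_def G_def card_image elim: digraph_iso_with_projE)
    then show "\<not> monochromatic c H \<and> \<not> rainbow c H"
      using assms(2) card_mono[of "{0}" "pverts H"] by (simp add: two_connected_def)
  qed
  moreover have "W_minus G F = k"
    by (rule W_minus_eqI[OF worm, of "\<lambda>_. 0"]) (auto simp: G_def True)
  ultimately show ?thesis by (auto simp: worm_colorable_def)
next
  case False
  interpret F: pair_graph F by fact
  define m where "m = k - 1"
  have m: "0 < m" "k = Suc m" using False assms(3) by (auto simp: m_def)
  have "3 \<le> card (pverts F)" using assms(2) by (simp add: two_connected_def)
  then obtain E :: "nat set set" and \<kappa> :: "nat \<Rightarrow> nat" where
    E: "finite (\<Union>E)" "sparse (card (parcs F)) E" "forces_mono m E"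
      "\<And>e. e \<in> E \<Longrightarrow> card e = card (pverts F)" "\<kappa> ` \<Union>E \<subseteq> {..m}"
      "\<And>e. e \<in> E \<Longrightarrow> \<not> inj_on \<kappa> e" "\<And>e d. e \<in> E \<Longrightarrow> \<not> (\<forall>v\<in>e. \<kappa> v = d)"
    using sparse_bicolored_hypergraph by metis
  have "\<exists>b. bij_betw b (pverts F) e" if "e \<in> E" for e
  proof (rule finite_same_card_bij[OF F.pair_finite_verts])
    show "finite e" using that by (intro finite_subset[OF _ E(1)]) auto
  qed (simp add: E(4)[OF that])
  then obtain \<sigma> where \<sigma>: "\<And>e. e \<in> E \<Longrightarrow> bij_betw (\<sigma> e) (pverts F) e" by metis
  define G where "G = planted F \<sigma> E"
  have V: "pverts G = \<Union>E" by (simp add: G_def planted_def)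
  have worm: "worm_coloring G F \<kappa>"
    unfolding worm_coloring_def
  proof (intro allI impI, elim conjE)
    fix H :: "nat pair_pre_digraph"
    assume "pair_graph H" "subgraph (with_proj H) (with_proj G)" "digraph_iso (with_proj F) (with_proj H)"
    then have H: "pverts H \<in> E"
      using copy_in_planted[OF assms(1,2) E(1,2) \<sigma>] by (simp add: G_def)
    then show "\<not> monochromatic \<kappa> H \<and> \<not> rainbow \<kappa> H"
      using E(6)[OF H] E(7)[OF H] unfolding monochromatic_def rainbow_def by blast
  qed
  have "k \<le> card (c ` pverts G)" if c: "worm_coloring G F c" for c :: "nat \<Rightarrow> nat"
  proof (rule ccontr)
    assume "\<not> ?thesis"
    then have le: "card (c ` \<Union>E) \<le> m" using m V by simp
    obtain h where h: "bij_betw h (c ` \<Union>E) {0..<card (c ` \<Union>E)}"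
      using ex_bij_betw_finite_nat E(1) by blast
    \<comment> \<open>The colors of \<open>c\<close>, at most \<open>m\<close> in number, are
      renumbered to lie below \<open>m\<close>. Vertices outside the hypergraph get 0, an admissible
      value because \<open>m > 0\<close>.\<close>
    define \<chi> where "\<chi> v = (if v \<in> \<Union>E then h (c v) else 0)" for v
    have "\<chi> v < m" for v
    proof (cases "v \<in> \<Union>E")
      case True
      then have "h (c v) \<in> {0..<card (c ` \<Union>E)}" using h by (blast dest: bij_betwE)
      then show ?thesis using True le by (simp add: \<chi>_def)
    qed (use m in \<open>simp add: \<chi>_def\<close>)
    then obtain e d where e: "e \<in> E" "\<forall>v\<in>e. \<chi> v = d"
      using forces_monoD[OF E(3)] by blast
    obtain H where H: "pair_graph H" "subgraph (with_proj H) (with_proj G)"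
      "digraph_iso (with_proj F) (with_proj H)" "pverts H = e"
      using planted_copy[OF assms(1) E(1) \<sigma> e(1)] unfolding G_def by blast
    have "c u = c v" if "u \<in> e" "v \<in> e" for u v
    proof (rule inj_onD[OF bij_betw_imp_inj_on[OF h]])
      have uv: "u \<in> \<Union>E" "v \<in> \<Union>E" using that e(1) by auto
      then show "c u \<in> c ` \<Union>E" "c v \<in> c ` \<Union>E" by auto
      show "h (c u) = h (c v)" using uv e(2) that unfolding \<chi>_def by metis
    qed
    then have "monochromatic c H" unfolding monochromatic_def H(4) by blast
    then show False using c H(1-3) unfolding worm_coloring_def by blast
  qed
  \<comment> \<open>That \<open>\<kappa>\<close> uses exactly \<open>k\<close> colors then follows
    from the lower bound just proved, applied to \<open>\<kappa>\<close> itself.\<close>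
  moreover have "card (\<kappa> ` pverts G) \<le> k"
    using card_mono[OF _ E(5)] m V by simp
  ultimately have "W_minus G F = k" using W_minus_eqI[OF worm] by blast
  moreover have "pair_graph G"
    unfolding G_def by (rule pair_graph_planted[OF assms(1) E(1) \<sigma>])
  ultimately show ?thesis using worm by (auto simp: worm_colorable_def)
qed

end
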